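(* If $G$ is a graph, then $\mu(G\boxtimes P_2) \ge \max\{n(G),\, 2\mu(G)\}$.
   Context: All graphs are finite, simple, undirected and connected; $n(G)$ is the number of vertices of $G$, and $P_2$ is the path on two vertices. For a graph $G$ and $X\subseteq V(G)$, two vertices $x,y\in V(G)$ are $X$-visible if there is a shortest $x,y$-path in $G$ none of whose internal vertices lies in $X$. A set $X\subseteq V(G)$ is a mutual-visibility set if its vertices are pairwise $X$-visible, and the mutual-visibility number $\mu(G)$ is the largest cardinality of a mutual-visibility set of $G$. The strong product $G\boxtimes H$ has vertex set $V(G)\times V(H)$, and two distinct vertices $(g,h)$ and $(g',h')$ are adjacent iff ($g=g'$ or $gg'\in E(G)$) and ($h=h'$ or $hh'\in E(H)$). *)

theory Defs
  imports "Graph_Theory.Graph_Theory"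
begin

text \<open>
  A finite simple undirected graph is a \<^typ>\<open>'a pair_pre_digraph\<close> satisfying
  \<^locale>\<open>pair_graph\<close>: an undirected edge is a pair of opposite arcs.  Paths are nonempty
  lists of pairwise distinct vertices (\<^const>\<open>vpath\<close>).
\<close>

definition path_graph :: "nat \<Rightarrow> nat pair_pre_digraph" where
  "path_graph n = \<lparr> pverts = {..<n},
     parcs = {(i, j). i < n \<and> j < n \<and> (j = Suc i \<or> i = Suc j)} \<rparr>"

definition strong_product ::
  "'a pair_pre_digraph \<Rightarrow> 'b pair_pre_digraph \<Rightarrow> ('a \<times> 'b) pair_pre_digraph" where
  "strong_product G H = \<lparr> pverts = pverts G \<times> pverts H,
     parcs = {((g, h), (g', h')).
       (g, h) \<in> pverts G \<times> pverts H \<and> (g', h') \<in> pverts G \<times> pverts H \<and>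
       (g, h) \<noteq> (g', h') \<and>
       (g = g' \<or> (g, g') \<in> parcs G) \<and> (h = h' \<or> (h, h') \<in> parcs H)} \<rparr>"

definition path_between :: "'a pair_pre_digraph \<Rightarrow> 'a \<Rightarrow> 'a list \<Rightarrow> 'a \<Rightarrow> bool" where
  "path_between G x p y \<longleftrightarrow> vpath p (with_proj G) \<and> hd p = x \<and> last p = y"

definition shortest_path :: "'a pair_pre_digraph \<Rightarrow> 'a \<Rightarrow> 'a list \<Rightarrow> 'a \<Rightarrow> bool" where
  "shortest_path G x p y \<longleftrightarrow> path_between G x p y \<and>
     (\<forall>q. path_between G x q y \<longrightarrow> vwalk_length p \<le> vwalk_length q)"

text \<open>The list \<open>butlast (tl p)\<close> consists of the internal vertices of \<open>p\<close>; it is empty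
  if \<open>p\<close> has at most two vertices.\<close>

definition visible :: "'a pair_pre_digraph \<Rightarrow> 'a set \<Rightarrow> 'a \<Rightarrow> 'a \<Rightarrow> bool" where
  "visible G X x y \<longleftrightarrow> (\<exists>p. shortest_path G x p y \<and> set (butlast (tl p)) \<inter> X = {})"

definition mutual_visibility_set :: "'a pair_pre_digraph \<Rightarrow> 'a set \<Rightarrow> bool" where
  "mutual_visibility_set G X \<longleftrightarrow>
     X \<subseteq> pverts G \<and> (\<forall>x\<in>X. \<forall>y\<in>X. x \<noteq> y \<longrightarrow> visible G X x y)"

definition mutual_visibility_number :: "'a pair_pre_digraph \<Rightarrow> nat" where
  "mutual_visibility_number G = Max {card X | X. mutual_visibility_set G X}"

lemma mutual_visibility_set_empty: "mutual_visibility_set G {}"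
  by (simp add: mutual_visibility_set_def)

lemma finite_mutual_visibility_cards:
  assumes "finite (pverts G)"
  shows "finite {card X | X. mutual_visibility_set G X}"
proof -
  have "{card X | X. mutual_visibility_set G X} \<subseteq> card ` Pow (pverts G)"
    by (auto simp: mutual_visibility_set_def)
  then show ?thesis
    using assms by (meson finite_Pow_iff finite_imageI finite_subset)
qed

text \<open>On a finite graph the maximum is attained.\<close>

lemma mutual_visibility_number_attained:
  assumes "finite (pverts G)"
  obtains X where "mutual_visibility_set G X" "card X = mutual_visibility_number G"
proof -
  have "mutual_visibility_number G \<in> {card X | X. mutual_visibility_set G X}"
    unfolding mutual_visibility_number_def
    using finite_mutual_visibility_cards[OF assms] mutual_visibility_set_empty
    by (intro Max_in) auto
  then show ?thesis using that by auto
qed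

lemma pair_graph_path_graph: "pair_graph (path_graph n)"
proof -
  have "finite {(i, j). i < n \<and> j < n \<and> (j = Suc i \<or> i = Suc j)}"
    by (rule finite_subset[of _ "{..<n} \<times> {..<n}"]) auto
  then show ?thesis
    by unfold_locales (auto simp: path_graph_def symmetric_def sym_def)
qed

lemma pair_graph_strong_product:
  assumes "pair_graph G" "pair_graph H"
  shows "pair_graph (strong_product G H)"
proof -
  interpret G: pair_graph G by fact
  interpret H: pair_graph H by fact
  have "finite (pverts (strong_product G H))"
    by (simp add: strong_product_def G.pair_finite_verts H.pair_finite_verts)
  moreover have "parcs (strong_product G H)
      \<subseteq> pverts (strong_product G H) \<times> pverts (strong_product G H)"
    by (auto simp: strong_product_def)
  ultimately have "finite (parcs (strong_product G H))"
    by (meson finite_SigmaI finite_subset)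
  with \<open>finite (pverts (strong_product G H))\<close> show ?thesis
    by unfold_locales
      (auto simp: strong_product_def symmetric_def sym_def
        dest: G.arcs_symmetric H.arcs_symmetric)
qed

end

(* In the strong product of G with a complete graph H, distances between different G-fibres are
   those of G: projecting a walk to G never lengthens it, and a shortest path of G lifts to a
   shortest path under any choice of H-coordinates.  With H = P_2 the set V(G) x {0} is a
   mutual-visibility set, the inner vertices being routed through layer 1, and so is X x {0, 1}
   for a mutual-visibility set X of G. *)

theory Submission
  imports Defs
begin

lemma vwalk_arcs_map: "vwalk_arcs (map f p) = map (map_prod f f) (vwalk_arcs p)"
  by (induction p rule: vwalk_arcs.induct) auto

text \<open>When a vertex recurs, \<open>vwalk_to_vpath\<close> resumes at its next occurrence, so
  each step only discards entries.\<close>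

lemma vwalk_to_vpath_length_le: "length (vwalk_to_vpath p) \<le> length p"
proof (induction p rule: vwalk_to_vpath_induct3)
  case (in_set x xs)
  then show ?case
    using length_dropWhile_le[of "\<lambda>y. y \<noteq> x" xs] by simp
qed auto

text \<open>Bridge to the results below, which are stated for an arbitrary complete second
  factor.\<close>

lemma complete_digraph_path_graph_2: "complete_digraph 2 (with_proj (path_graph 2))"
  by (auto simp: complete_digraph_pair_def path_graph_def)

lemma pverts_strong_product [simp]: "pverts (strong_product G H) = pverts G \<times> pverts H"
  by (simp add: strong_product_def)

text \<open>Since H is complete, any two layers are equal or adjacent, so \<open>c\<close> may
  choose the layer of each vertex freely. The first coordinates alone keep the lifted vertices
  distinct.\<close>

lemma vpath_strong_product_lift:
  assumes "pair_graph G" "complete_digraph n (with_proj H)" "vpath p (with_proj G)"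
    and c: "\<And>v. c v \<in> pverts H"
  shows "vpath (map (\<lambda>v. (v, c v)) p) (with_proj (strong_product G H))"
proof -
  interpret G: pair_graph G by fact
  have arcs: "set (vwalk_arcs p) \<subseteq> parcs G" and verts: "set p \<subseteq> pverts G"
    and "p \<noteq> []" "distinct p"
    using assms(3) by (auto simp: vpath_def vwalk_def)
  have "((u, c u), (v, c v)) \<in> parcs (strong_product G H)" if "(u, v) \<in> parcs G" for u v
    using that c assms(2) G.wellformed'[OF that] G.no_loops'[OF that]
    by (auto simp: strong_product_def complete_digraph_pair_def)
  then have "set (vwalk_arcs (map (\<lambda>v. (v, c v)) p)) \<subseteq> parcs (strong_product G H)"
    using arcs by (auto simp: vwalk_arcs_map)
  then show ?thesis
    using verts c \<open>p \<noteq> []\<close> \<open>distinct p\<close>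
    by (auto simp: vpath_def vwalk_def distinct_map inj_on_def)
qed

text \<open>An arc that changes only the H-coordinate projects to a repeated vertex, not to an arc
  of G; \<open>remdups_adj\<close> removes these stalls.\<close>

lemma vwalk_strong_product_project:
  assumes "vwalk q (with_proj (strong_product G H))"
  shows "vwalk (remdups_adj (map fst q)) (with_proj G)"
  using assms
proof (induction q rule: vwalk_induct)
  case (Base u)
  then show ?case by auto
next
  case (Cons u v es)
  \<comment> \<open>\<open>remdups_adj\<close> keeps the first entry, so the projected tail still
    starts at \<open>fst v\<close>, where the new arc attaches.\<close>
  obtain r where r: "remdups_adj (map fst (v # es)) = fst v # r"
    by (cases "remdups_adj (map fst (v # es))") (auto dest: arg_cong[of _ _ hd])
  show ?case
  proof (cases "fst u = fst v")
    case True
    then show ?thesis using Cons.IH by simp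
  next
    case False
    then have "(fst u, fst v) \<in> parcs G" "fst u \<in> pverts G"
      using Cons.hyps by (auto simp: strong_product_def)
    then show ?thesis
      using False Cons.IH r by (auto intro!: vwalk_consI)
  qed
qed

lemma shortest_path_strong_product_lift:
  assumes "pair_graph G" "complete_digraph n (with_proj H)" and p: "shortest_path G x p y"
    and c: "\<And>v. c v \<in> pverts H"
  shows "shortest_path (strong_product G H) (x, c x) (map (\<lambda>v. (v, c v)) p) (y, c y)"
  unfolding shortest_path_def
proof (intro conjI allI impI)
  have path: "vpath p (with_proj G)" "hd p = x" "last p = y" "p \<noteq> []"
    using p by (auto simp: shortest_path_def path_between_def vpath_def vwalk_def)
  then show "path_between (strong_product G H) (x, c x) (map (\<lambda>v. (v, c v)) p) (y, c y)"
    using vpath_strong_product_lift[OF assms(1,2) path(1), of c] c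
    by (simp add: path_between_def hd_map last_map)
next
  fix q assume q: "path_between (strong_product G H) (x, c x) q (y, c y)"
  \<comment> \<open>This walk may revisit a vertex of G, because distinct vertices of
    \<open>q\<close> can lie in one fibre. Only after \<open>vwalk_to_vpath\<close> is it a path
    that competes with \<open>p\<close>.\<close>
  define r where "r = remdups_adj (map fst q)"
  have "vwalk q (with_proj (strong_product G H))" "hd q = (x, c x)" "last q = (y, c y)" "q \<noteq> []"
    using q by (auto simp: path_between_def vpath_def vwalk_def)
  then have "path_between G x (vwalk_to_vpath r) y"
    unfolding r_def path_between_def
    by (simp add: vwalk_to_vpath_vpath vwalk_to_vpath_hd vwalk_to_vpath_last
        vwalk_strong_product_project hd_map last_map)
  then have "length p - 1 \<le> length (vwalk_to_vpath r) - 1"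
    using p by (simp add: shortest_path_def)
  also have "length (vwalk_to_vpath r) \<le> length q"
    using vwalk_to_vpath_length_le[of r] remdups_adj_length[of "map fst q"]
    by (simp add: r_def)
  finally show "vwalk_length (map (\<lambda>v. (v, c v)) p) \<le> vwalk_length q"
    by (simp add: diff_le_mono)
qed

text \<open>The endpoints keep their own layers \<open>i\<close> and \<open>j\<close>, while the
  whole interior of \<open>p\<close> is lifted to the single layer \<open>k\<close>; hence only the
  copies in layer \<open>k\<close> have to avoid \<open>X\<close>.\<close>

lemma visible_strong_product:
  assumes "pair_graph G" "complete_digraph n (with_proj H)" and p: "shortest_path G x p y" and "x \<noteq> y"
    and "i \<in> pverts H" "j \<in> pverts H" "k \<in> pverts H"
    and avoid: "\<And>v. v \<in> set (butlast (tl p)) \<Longrightarrow> (v, k) \<notin> X"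
  shows "visible (strong_product G H) X (x, i) (y, j)"
proof -
  \<comment> \<open>The test for \<open>x\<close> comes first, so \<open>c y = j\<close> relies on
    \<open>x \<noteq> y\<close>.\<close>
  define c where "c v = (if v = x then i else if v = y then j else k)" for v
  have "c v \<in> pverts H" for v
    using assms(5-7) by (simp add: c_def)
  from shortest_path_strong_product_lift[where c = c, OF assms(1-3) this]
  have short: "shortest_path (strong_product G H) (x, i) (map (\<lambda>v. (v, c v)) p) (y, j)"
    using \<open>x \<noteq> y\<close> by (simp add: c_def)
  have ends: "hd p = x" "last p = y" "p \<noteq> []" "distinct p"
    using p by (auto simp: shortest_path_def path_between_def vpath_def vwalk_def)
  \<comment> \<open>A path does not return to its endpoints, so \<open>c\<close> takes the value
    \<open>k\<close> on the whole interior.\<close>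
  have "v \<noteq> x \<and> v \<noteq> y" if v: "v \<in> set (butlast (tl p))" for v
  proof -
    obtain t where t: "p = x # t"
      using ends by (cases p) auto
    with v have "t \<noteq> []" by auto
    then have "t = butlast t @ [y]"
      using ends t append_butlast_last_id[of t] by simp
    then have "distinct (butlast t @ [y])"
      using ends t by (metis distinct.simps(2))
    then show ?thesis
      using v t ends by (auto dest: in_set_butlastD)
  qed
  then have "set (butlast (tl (map (\<lambda>v. (v, c v)) p))) \<inter> X = {}"
    using avoid by (auto simp: c_def simp flip: map_tl map_butlast)
  then show ?thesis
    using short by (auto simp: visible_def)
qed

text \<open>The path \<open>[u, v]\<close> has no internal vertices, so no set can block it. This
  serves pairs in one fibre, which \<open>visible_strong_product\<close> excludes.\<close>

lemma visible_adjacent: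
  assumes "pair_graph G" "(u, v) \<in> parcs G"
  shows "visible G X u v"
proof -
  interpret G: pair_graph G by fact
  have "u \<noteq> v"
    using assms(2) G.no_loops' by blast
  \<comment> \<open>A path with distinct ends has at least two entries.\<close>
  have "vwalk_length [u, v] \<le> vwalk_length q" if "path_between G u q v" for q
  proof (cases q)
    case (Cons a t)
    then show ?thesis
      using that \<open>u \<noteq> v\<close> by (cases t) (auto simp: path_between_def)
  qed (use that in \<open>auto simp: path_between_def vpath_def vwalk_def\<close>)
  moreover have "path_between G u [u, v] v"
    using assms(2) \<open>u \<noteq> v\<close> G.wellformed'[OF assms(2)]
    by (auto simp: path_between_def vpath_def vwalk_def)
  ultimately have "shortest_path G u [u, v] v"
    by (simp add: shortest_path_def)
  then show ?thesis
    unfolding visible_def by (intro exI[of _ "[u, v]"]) simp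
qed

lemma shortest_path_exists:
  assumes "pair_graph G" "Digraph_Component.connected (with_proj G)"
    and "x \<in> pverts G" "y \<in> pverts G"
  obtains p where "shortest_path G x p y"
proof -
  interpret G: pair_graph G by fact
  have "strongly_connected (with_proj G)"
    using G.symmetric_connected_imp_strongly_connected G.sym_arcs assms(2) by blast
  then have "x \<rightarrow>\<^sup>*\<^bsub>with_proj G\<^esub> y"
    using assms(3,4) by (auto simp: strongly_connected_def)
  then obtain p0 where "path_between G x p0 y"
    by (auto simp: G.reachable_vpath_conv path_between_def)
  \<comment> \<open>Lengths are natural numbers, so one path attains the minimum.\<close>
  then obtain p where "path_between G x p y"
      "\<forall>q. path_between G x q y \<longrightarrow> vwalk_length p \<le> vwalk_length q"
    using ex_has_least_nat[of "\<lambda>q. path_between G x q y" p0 vwalk_length] by blast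
  then show thesis
    using that by (simp add: shortest_path_def)
qed

lemma card_le_mutual_visibility_number:
  assumes "finite (pverts G)" "mutual_visibility_set G X"
  shows "card X \<le> mutual_visibility_number G"
  unfolding mutual_visibility_number_def
  using finite_mutual_visibility_cards[OF assms(1)] assms(2) by (intro Max_ge) auto

text \<open>Layer \<open>k\<close> is disjoint from the set, so any shortest path of G can be used,
  whatever its interior.\<close>

lemma mutual_visibility_set_layer:
  assumes "pair_graph G" "Digraph_Component.connected (with_proj G)" "complete_digraph n (with_proj H)"
    and "i \<in> pverts H" "k \<in> pverts H" "i \<noteq> k"
  shows "mutual_visibility_set (strong_product G H) (pverts G \<times> {i})"
  unfolding mutual_visibility_set_def
proof (intro conjI ballI impI)
  show "pverts G \<times> {i} \<subseteq> pverts (strong_product G H)"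
    using assms(4) by auto
next
  fix a b assume ab: "a \<in> pverts G \<times> {i}" "b \<in> pverts G \<times> {i}" "a \<noteq> b"
  then obtain x y where xy: "a = (x, i)" "b = (y, i)" "x \<in> pverts G" "y \<in> pverts G" "x \<noteq> y"
    by auto
  then obtain p where "shortest_path G x p y"
    using shortest_path_exists assms(1,2) by metis
  then show "visible (strong_product G H) (pverts G \<times> {i}) a b"
    unfolding xy
      by (rule visible_strong_product[OF assms(1,3), where k = k]) (use xy assms(4-6) in auto)
qed

text \<open>Two points of one fibre are adjacent because H is complete. For different fibres, the
  visibility path in G has its interior outside \<open>X\<close>, so its lift avoids all copies of
  \<open>X\<close>.\<close>

lemma mutual_visibility_set_Times:
  assumes "pair_graph G" "pair_graph H" "complete_digraph n (with_proj H)" "mutual_visibility_set G X"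
  shows "mutual_visibility_set (strong_product G H) (X \<times> pverts H)"
  unfolding mutual_visibility_set_def
proof (intro conjI ballI impI)
  show "X \<times> pverts H \<subseteq> pverts (strong_product G H)"
    using assms(4) by (auto simp: mutual_visibility_set_def)
next
  fix a b assume ab: "a \<in> X \<times> pverts H" "b \<in> X \<times> pverts H" "a \<noteq> b"
  then obtain x i y j where eq: "a = (x, i)" "b = (y, j)"
    and mem: "x \<in> X" "y \<in> X" "i \<in> pverts H" "j \<in> pverts H"
    by auto
  show "visible (strong_product G H) (X \<times> pverts H) a b"
  proof (cases "x = y")
    case True
    then have "(a, b) \<in> parcs (strong_product G H)"
      using eq mem ab(3) assms(3,4)
      by (auto simp: strong_product_def complete_digraph_pair_def mutual_visibility_set_def)
    then show ?thesis
      by (rule visible_adjacent[OF pair_graph_strong_product[OF assms(1,2)]])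
  next
    case False
    then obtain p where p: "shortest_path G x p y" "set (butlast (tl p)) \<inter> X = {}"
      using assms(4) mem unfolding mutual_visibility_set_def visible_def by blast
    \<comment> \<open>Every layer is equally safe for the interior; \<open>i\<close> is one at
      hand.\<close>
    from p(1) False show ?thesis
      unfolding eq
      by (rule visible_strong_product[OF assms(1,3), where k = i]) (use p(2) mem in auto)
  qed
qed

theorem theorem5p1:
  fixes G :: "'a pair_pre_digraph"
  assumes "pair_graph G"
    and "Digraph_Component.connected (with_proj G)"
  shows "mutual_visibility_number (strong_product G (path_graph 2))
    \<ge> max (card (pverts G)) (2 * mutual_visibility_number G)"
proof -
  interpret G: pair_graph G by fact
  have V: "pverts (path_graph 2) = {..<2}"
    by (simp add: path_graph_def)
  have fin: "finite (pverts (strong_product G (path_graph 2)))"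
    by (simp add: V G.pair_finite_verts)
  \<comment> \<open>Layer 0 is the set and layer 1 carries the interiors.\<close>
  have "mutual_visibility_set (strong_product G (path_graph 2)) (pverts G \<times> {0})"
    by (rule mutual_visibility_set_layer[OF assms complete_digraph_path_graph_2, where k = 1])
      (simp_all add: V)
  from card_le_mutual_visibility_number[OF fin this]
  have "card (pverts G) \<le> mutual_visibility_number (strong_product G (path_graph 2))"
    by (simp add: card_cartesian_product)
  moreover obtain X where X: "mutual_visibility_set G X" "card X = mutual_visibility_number G"
    using mutual_visibility_number_attained[OF G.pair_finite_verts] .
  \<comment> \<open>Taking a maximum set in both layers doubles its cardinality.\<close>
  have "mutual_visibility_set (strong_product G (path_graph 2)) (X \<times> pverts (path_graph 2))"
    using assms(1) pair_graph_path_graph complete_digraph_path_graph_2 X(1)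
    by (rule mutual_visibility_set_Times)
  from card_le_mutual_visibility_number[OF fin this]
  have "2 * mutual_visibility_number G
      \<le> mutual_visibility_number (strong_product G (path_graph 2))"
    by (simp add: card_cartesian_product V X(2) mult.commute)
  ultimately show ?thesis by simp
qed

end
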